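(* Let $d\ge 1$ and $n$ be such that $2^d+d=n/2$. Then every deterministic OBDD (with any variable order) computing $\mathtt{SSA}_n$ has width at least $2^{2^d}$, i.e. $\mathsf{OBDD}(\mathtt{SSA}_n)\ge 2^{2^d}$.
   Context: Shuffled Storage Access function $\mathtt{SSA}_n:\{0,1\}^n\to\{0,1\}$ ($n$ even, $2^d+d=n/2$): for input $x$, let $I_0=(2i_1<\dots<2i_m)$ be the sorted list of even indices $2i$ with $x_{2i-1}=0$ and $I_1=(2j_1<\dots<2j_k)$ the sorted list of even indices $2i$ with $x_{2i-1}=1$. Let $\mathtt{ShiftX}((a_1,\dots,a_t),b)=(a_2,\dots,a_t,a_1\oplus b)$. Start with $\alpha=0^{2^d}$ and for $r=1,\dots,m$ set $\alpha:=\mathtt{ShiftX}(\alpha,x_{2i_r})$; start with $\beta=0^d$ and for $r=1,\dots,k$ set $\beta:=\mathtt{ShiftX}(\beta,x_{2j_r})$. Then $\mathtt{SSA}_n(x)=\mathtt{SA}_d(\alpha,\beta)$, where the storage access function $\mathtt{SA}_d(\alpha,\beta)$ returns the bit of the storage $\alpha\in\{0,1\}^{2^d}$ at the address encoded in binary by $\beta\in\{0,1\}^d$. A deterministic OBDD of width $m$ over $x_1,\dots,x_n$ consists of a permutation $\pi$ of $\{1,\dots,n\}$, a set $S$ of $m$ states, an initial state, maps $T_j^0,T_j^1:S\to S$ for each step $j$, and an accepting set; on input $x$ it applies $T_j^{x_{\pi(j)}}$ at step $j$ starting from the initial state and outputs $1$ iff the final state is accepting. $\mathsf{OBDD}(f)$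 is the minimum width over all such OBDDs computing $f$. *)

theory Defs
  imports Main "HOL-Library.FuncSet" "HOL-Combinatorics.Permutations"
begin

text \<open>
  An input of length \<open>n\<close> is a function \<open>x\<close> with \<open>x i\<close> the value of the variable \<open>x\<^sub>i\<close>
  (1-based), \<open>undefined\<close> outside of \<open>{1..n}\<close>. The bits 0 and 1 are \<^const>\<open>False\<close> and \<^const>\<open>True\<close>,
  so that exclusive or is \<open>\<noteq>\<close>.
\<close>

definition inputs :: "nat \<Rightarrow> (nat \<Rightarrow> bool) set" where
  "inputs n = {1..n} \<rightarrow>\<^sub>E UNIV"

fun ShiftX :: "bool list \<Rightarrow> bool \<Rightarrow> bool list" where
  "ShiftX [] b = []"
| "ShiftX (a # as) b = as @ [a \<noteq> b]"

text \<open>Addresses are read with the most significant bit first; address 0 is the first bit of the storage.\<close>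

definition SA :: "bool list \<Rightarrow> bool list \<Rightarrow> bool" where
  "SA \<alpha> \<beta> = \<alpha> ! horner_sum of_bool 2 (rev \<beta>)"

definition marked_indices :: "nat \<Rightarrow> (nat \<Rightarrow> bool) \<Rightarrow> bool \<Rightarrow> nat list" where
  "marked_indices n x b = sorted_list_of_set {2 * i | i. i \<in> {1..n div 2} \<and> x (2 * i - 1) = b}"

definition shift_all :: "(nat \<Rightarrow> bool) \<Rightarrow> bool list \<Rightarrow> nat list \<Rightarrow> bool list" where
  "shift_all x \<alpha> ks = foldl (\<lambda>\<alpha> k. ShiftX \<alpha> (x k)) \<alpha> ks"

text \<open>Meaningful for even \<open>n\<close> with \<open>2 ^ d + d = n div 2\<close>, where \<open>n\<close> and \<open>d\<close> determine each other.\<close>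

definition SSA :: "nat \<Rightarrow> nat \<Rightarrow> (nat \<Rightarrow> bool) \<Rightarrow> bool" where
  "SSA d n x =
     SA (shift_all x (replicate (2 ^ d) False) (marked_indices n x False))
        (shift_all x (replicate d False) (marked_indices n x True))"

record 's obdd =
  var_order :: "nat \<Rightarrow> nat"
  states :: "'s set"
  init :: 's
  trans_map :: "nat \<Rightarrow> bool \<Rightarrow> 's \<Rightarrow> 's"
  accepting :: "'s set"

definition is_obdd :: "nat \<Rightarrow> 's obdd \<Rightarrow> bool" where
  "is_obdd n B \<longleftrightarrow>
     var_order B permutes {1..n} \<and>
     finite (states B) \<and>
     init B \<in> states B \<and>
     (\<forall>j\<in>{1..n}. \<forall>b. trans_map B j b \<in> states B \<rightarrow> states B) \<and>
     accepting B \<subseteq> states B"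

definition width :: "'s obdd \<Rightarrow> nat" where
  "width B = card (states B)"

fun state_after :: "'s obdd \<Rightarrow> (nat \<Rightarrow> bool) \<Rightarrow> nat \<Rightarrow> 's" where
  "state_after B x 0 = init B"
| "state_after B x (Suc j) = trans_map B (Suc j) (x (var_order B (Suc j))) (state_after B x j)"

definition computes :: "nat \<Rightarrow> 's obdd \<Rightarrow> ((nat \<Rightarrow> bool) \<Rightarrow> bool) \<Rightarrow> bool" where
  "computes n B f \<longleftrightarrow> (\<forall>x\<in>inputs n. state_after B x n \<in> accepting B \<longleftrightarrow> f x)"

text \<open>
  States range over natural numbers, which loses no generality since state sets are finite.
  As \<open>Inf {} = 0\<close> on \<^typ>\<open>nat\<close>, a positive lower bound entails that some OBDD computes \<open>f\<close>.
\<close>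

definition OBDD :: "nat \<Rightarrow> ((nat \<Rightarrow> bool) \<Rightarrow> bool) \<Rightarrow> nat" where
  "OBDD n f = Inf {width B | B :: nat obdd. is_obdd n B \<and> computes n B f}"

end

theory Submission
  imports Defs "HOL-Library.Nat_Bijection"
begin

text \<open>
  Cut the variable order after the step at which exactly \<open>2 ^ d\<close> of the even-indexed variables have
  been read. Fix the odd-indexed variables so that the even-indexed ones already read form the storage
  and the remaining \<open>d\<close> of them form the address. A storage of length \<open>2 ^ d\<close> receives exactly
  \<open>2 ^ d\<close> shifts, so it equals the sequence of bits read; any two different sequences disagree at
  some position, and the address of this position can still be chosen after the cut. Hence the
  \<open>2 ^ (2 ^ d)\<close> possible sequences lead to different states.
\<close>

section \<open>Deterministic OBDDs\<close>

lemma state_after_in_states: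
  assumes "is_obdd n B" "j \<le> n"
  shows "state_after B x j \<in> states B"
  using assms(2)
proof (induction j)
  case 0
  then show ?case using assms(1) by (simp add: is_obdd_def)
next
  case (Suc j)
  have "trans_map B (Suc j) b \<in> states B \<rightarrow> states B" for b
    using assms(1) Suc.prems by (simp add: is_obdd_def)
  then show ?case using Suc by auto
qed

lemma state_after_cong:
  assumes "\<And>i. i \<in> {1..j} \<Longrightarrow> x (var_order B i) = y (var_order B i)"
  shows "state_after B x j = state_after B y j"
  using assms by (induction j) auto

lemma state_after_extend:
  assumes "state_after B x j = state_after B y j" "j \<le> k"
    and "\<And>i. i \<in> {j<..k} \<Longrightarrow> x (var_order B i) = y (var_order B i)"
  shows "state_after B x k = state_after B y k"
  using assms(2,3)
proof (induction k rule: dec_induct)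
  case base
  then show ?case using assms(1) by simp
next
  case (step k)
  have "x (var_order B (Suc k)) = y (var_order B (Suc k))"
    using step.hyps(1) by (intro step.prems) auto
  moreover have "state_after B x k = state_after B y k"
    by (rule step.IH) (use step.prems in auto)
  ultimately show ?case by simp
qed

text \<open>If two members of \<open>X\<close> shared a state after \<open>j\<close> steps,
  \<open>x'\<close> and \<open>y'\<close> would share it too, and their common remaining bits would
  lead both to the same final state, although \<open>f\<close> separates them.\<close>

lemma width_ge_card_fooling_set:
  assumes B: "is_obdd n B" "computes n B f" and "j \<le> n"
    and fool: "\<And>x y. \<lbrakk>x \<in> X; y \<in> X; x \<noteq> y\<rbrakk> \<Longrightarrow> \<exists>x'\<in>inputs n. \<exists>y'\<in>inputs n.
      (\<forall>i\<in>{1..j}. x' (var_order B i) = x (var_order B i) \<and> y' (var_order B i) = y (var_order B i)) \<and>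
      (\<forall>i\<in>{j<..n}. x' (var_order B i) = y' (var_order B i)) \<and> f x' \<noteq> f y'"
  shows "card X \<le> width B"
proof -
  have "inj_on (\<lambda>x. state_after B x j) X"
  proof (rule inj_onI, rule ccontr)
    fix x y
    assume xy: "x \<in> X" "y \<in> X" "state_after B x j = state_after B y j" "x \<noteq> y"
    obtain x' y' where x'y': "x' \<in> inputs n" "y' \<in> inputs n" "f x' \<noteq> f y'"
      and pre: "\<And>i. i \<in> {1..j} \<Longrightarrow> x' (var_order B i) = x (var_order B i)"
        "\<And>i. i \<in> {1..j} \<Longrightarrow> y' (var_order B i) = y (var_order B i)"
      and suf: "\<And>i. i \<in> {j<..n} \<Longrightarrow> x' (var_order B i) = y' (var_order B i)"
      using fool[OF xy(1,2,4)] by blast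
    have "state_after B x' j = state_after B x j" by (rule state_after_cong) (rule pre)
    also note xy(3)
    also have "state_after B y j = state_after B y' j"
      by (rule state_after_cong) (rule pre(2)[symmetric])
    finally have "state_after B x' n = state_after B y' n"
      using \<open>j \<le> n\<close> suf by (rule state_after_extend)
    then show False using B(2) x'y' unfolding computes_def by metis
  qed
  moreover have "(\<lambda>x. state_after B x j) ` X \<subseteq> states B"
    using state_after_in_states[OF B(1) \<open>j \<le> n\<close>] by blast
  moreover have "finite (states B)" using B(1) by (simp add: is_obdd_def)
  ultimately show ?thesis unfolding width_def by (rule card_inj_on_le)
qed

text \<open>Makes the set under \<open>Inf\<close> in \<open>OBDD\<close> nonempty. The witness
  forgets nothing: its state encodes the set of true variables read so far.\<close>

lemma ex_obdd_computes: "\<exists>B :: nat obdd. is_obdd n B \<and> computes n B f"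
proof -
  \<comment> \<open>A set is turned back into an input, \<open>undefined\<close> outside
    \<open>{1..n}\<close> to match \<open>inputs n\<close>.\<close>
  define g where "g S = f (\<lambda>i. if i \<in> {1..n} then i \<in> S else undefined)" for S
  define B :: "nat obdd" where "B = \<lparr>var_order = id, states = set_encode ` Pow {1..n},
    init = set_encode {},
    trans_map = (\<lambda>j b s. if b then set_encode (insert j (set_decode s)) else s),
    accepting = set_encode ` {S \<in> Pow {1..n}. g S}\<rparr>"
  have fin: "finite S" if "S \<subseteq> {1..n}" for S
    using that by (rule finite_subset) simp
  have "is_obdd n B"
    \<comment> \<open>The initial state \<open>set_encode {}\<close> simplifies to 0, which still
      has to be recognised as a state.\<close>
    using fin image_eqI[of 0 set_encode "{}"]
    by (auto simp: B_def is_obdd_def permutes_id intro!: imageI)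
  moreover have state: "state_after B x j = set_encode {i \<in> {1..j}. x i}" for x j
  proof (induction j)
    case (Suc j)
    have "{i \<in> {1..Suc j}. x i} =
        (if x (Suc j) then insert (Suc j) {i \<in> {1..j}. x i} else {i \<in> {1..j}. x i})"
      by (auto simp: le_Suc_eq)
    then show ?case using Suc by (simp add: B_def)
  qed (simp add: B_def)
  have "computes n B f"
    unfolding computes_def
  proof
    fix x assume x: "x \<in> inputs n"
    let ?S = "{i \<in> {1..n}. x i}"
    have "(\<lambda>i. if i \<in> {1..n} then i \<in> ?S else undefined) = x"
      using x by (auto simp: inputs_def PiE_def extensional_def fun_eq_iff)
    then have "g ?S \<longleftrightarrow> f x" by (simp only: g_def)
    have "set_encode ?S \<in> set_encode ` {S \<in> Pow {1..n}. g S} \<longleftrightarrow> ?S \<in> {S \<in> Pow {1..n}. g S}"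
      by (rule inj_on_image_mem_iff[OF inj_on_set_encode]) (use fin in auto)
    also have "\<dots> \<longleftrightarrow> g ?S" by blast
    also note \<open>g ?S \<longleftrightarrow> f x\<close>
    finally show "state_after B x n \<in> accepting B \<longleftrightarrow> f x"
      unfolding state by (simp add: B_def)
  qed
  ultimately show ?thesis by blast
qed

lemma le_OBDD:
  assumes "\<And>B :: nat obdd. \<lbrakk>is_obdd n B; computes n B f\<rbrakk> \<Longrightarrow> m \<le> width B"
  shows "m \<le> OBDD n f"
  unfolding OBDD_def
  by (rule cInf_greatest) (use ex_obdd_computes[of n f] assms in auto)

text \<open>A discrete intermediate value argument: the count is 0 at \<open>j = 0\<close> and each
  step raises it by at most one.\<close>

lemma ex_card_Int_image_atMost_eq:
  fixes \<pi> :: "nat \<Rightarrow> 'a"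
  assumes "N \<le> card (E \<inter> \<pi> ` {1..k})"
  shows "\<exists>j\<le>k. card (E \<inter> \<pi> ` {1..j}) = N"
  using assms
proof (induction k)
  case (Suc k)
  have "E \<inter> \<pi> ` {1..Suc k} \<subseteq> insert (\<pi> (Suc k)) (E \<inter> \<pi> ` {1..k})"
    by (auto simp: le_Suc_eq)
  then have "card (E \<inter> \<pi> ` {1..Suc k}) \<le> card (insert (\<pi> (Suc k)) (E \<inter> \<pi> ` {1..k}))"
    by (intro card_mono) auto
  also have "\<dots> \<le> Suc (card (E \<inter> \<pi> ` {1..k}))"
    by (rule card_insert_le_m1) auto
  finally consider "N \<le> card (E \<inter> \<pi> ` {1..k})" | "N = card (E \<inter> \<pi> ` {1..Suc k})"
    using Suc.prems by linarith
  then show ?case using Suc.IH le_SucI by cases blast+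
qed simp

section \<open>Shuffled storage access\<close>

text \<open>Each shift removes a leading \<open>False\<close> and appends its exclusive or with the
  bit read, which is that bit. The suffix \<open>bs\<close> holds the bits already appended, so that
  the induction goes through.\<close>

lemma shift_all_replicate_append:
  "shift_all x (replicate (length ks) False @ bs) ks = bs @ map x ks"
proof (induction ks arbitrary: bs)
  case (Cons k ks)
  then show ?case using Cons.IH[of "bs @ [x k]"] by (simp add: shift_all_def)
qed (simp add: shift_all_def)

lemma shift_all_replicate:
  "length ks = m \<Longrightarrow> shift_all x (replicate m False) ks = map x ks"
  using shift_all_replicate_append[of x ks "[]"] by auto

text \<open>The address consists of the \<open>d\<close> binary digits of \<open>i\<close>, reversed
  because \<open>SA\<close> reads the most significant one first.\<close>

lemma ex_address:
  assumes "i < 2 ^ d"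
  shows "\<exists>\<beta>. length \<beta> = d \<and> (\<forall>\<alpha>. SA \<alpha> \<beta> = \<alpha> ! i)"
proof (intro exI conjI allI)
  show "SA \<alpha> (rev (map (bit i) [0..<d])) = \<alpha> ! i" for \<alpha>
    using assms by (simp add: SA_def horner_sum_bit_eq_take_bit take_bit_nat_eq_self)
qed simp

text \<open>Turns a bit list into a set of true positions, the form in which
  \<open>split_input\<close> takes the even-indexed bits.\<close>

lemma ex_set_map_mem_eq:
  assumes "distinct ks" "length bs = length ks"
  shows "\<exists>W\<subseteq>set ks. map (\<lambda>k. k \<in> W) ks = bs"
proof (intro exI conjI)
  let ?W = "{ks ! l | l. l < length ks \<and> bs ! l}"
  show "?W \<subseteq> set ks" by auto
  show "map (\<lambda>k. k \<in> ?W) ks = bs"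
    using assms by (auto intro!: nth_equalityI simp: nth_eq_iff_index_eq)
qed

definition even_indices :: "nat \<Rightarrow> nat set" where
  "even_indices n = {i \<in> {1..n}. even i}"

lemma even_indices_eq: "even_indices n = (*) 2 ` {1..n div 2}"
  by (auto simp: even_indices_def image_iff elim!: evenE)

lemma finite_even_indices [simp]: "finite (even_indices n)"
  by (simp add: even_indices_def)

lemma card_even_indices: "card (even_indices n) = n div 2"
  by (simp add: even_indices_eq card_image inj_on_def)

text \<open>The bits at positions in \<open>P\<close> go to the storage, the other ones to the address.\<close>

definition split_input :: "nat \<Rightarrow> nat set \<Rightarrow> nat set \<Rightarrow> nat \<Rightarrow> bool" where
  "split_input n P S =
     (\<lambda>i. if i \<in> {1..n} then if even i then i \<in> S else Suc i \<notin> P else undefined)"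

lemma split_input_in_inputs: "split_input n P S \<in> inputs n"
  by (auto simp: split_input_def inputs_def)

lemma split_input_cong:
  assumes "i \<in> S \<longleftrightarrow> i \<in> T"
  shows "split_input n P S i = split_input n P T i"
  using assms by (simp add: split_input_def)

lemma marked_indices_split_input:
  "marked_indices n (split_input n P S) b =
     sorted_list_of_set (if b then even_indices n - P else even_indices n \<inter> P)"
proof -
  have "split_input n P S (2 * i - 1) \<longleftrightarrow> 2 * i \<notin> P" if "i \<in> {1..n div 2}" for i
    using that by (auto simp: split_input_def)
  then have "{2 * i | i. i \<in> {1..n div 2} \<and> split_input n P S (2 * i - 1) = b} =
      (if b then even_indices n - P else even_indices n \<inter> P)"
    unfolding even_indices_eq by auto
  then show ?thesis by (simp add: marked_indices_def)
qed

text \<open>Storage and address receive exactly as many shifts as they have cells, so every initial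
  zero is shifted out and the plain bits remain.\<close>

lemma SSA_split_input:
  assumes "card (even_indices n \<inter> P) = 2 ^ d" "card (even_indices n - P) = d"
  shows "SSA d n (split_input n P S) =
    SA (map (\<lambda>k. k \<in> S) (sorted_list_of_set (even_indices n \<inter> P)))
       (map (\<lambda>k. k \<in> S) (sorted_list_of_set (even_indices n - P)))"
proof -
  have *: "map (split_input n P S) ks = map (\<lambda>k. k \<in> S) ks" if "set ks \<subseteq> even_indices n" for ks
    using that by (auto simp: split_input_def even_indices_def)
  show ?thesis
    using assms by (simp add: SSA_def marked_indices_split_input shift_all_replicate *)
qed

text \<open>\<open>S\<close> and \<open>T\<close> differ at some \<open>k\<close>; \<open>W\<close>
  makes the address point to the place of \<open>k\<close> in the storage, so the output tells
  whether \<open>k\<close> is set.\<close>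

lemma SSA_split_input_distinguish:
  assumes card: "card (even_indices n \<inter> P) = 2 ^ d" "card (even_indices n - P) = d"
    and ST: "S \<subseteq> even_indices n \<inter> P" "T \<subseteq> even_indices n \<inter> P" "S \<noteq> T"
  shows "\<exists>W \<subseteq> even_indices n - P.
    SSA d n (split_input n P (S \<union> W)) \<noteq> SSA d n (split_input n P (T \<union> W))"
proof -
  let ?ks = "sorted_list_of_set (even_indices n \<inter> P)"
  let ?ls = "sorted_list_of_set (even_indices n - P)"
  obtain k where k: "k \<in> even_indices n \<inter> P" "k \<in> S \<longleftrightarrow> k \<notin> T" using ST by blast
  then have "k \<in> set ?ks" by simp
  then obtain i where i: "i < length ?ks" "?ks ! i = k" unfolding in_set_conv_nth by blast
  then obtain \<beta> where \<beta>: "length \<beta> = d" "\<And>\<alpha>. SA \<alpha> \<beta> = \<alpha> ! i"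
    using ex_address[of i d] card by auto
  then obtain W where W: "W \<subseteq> set ?ls" "map (\<lambda>k. k \<in> W) ?ls = \<beta>"
    using ex_set_map_mem_eq[of ?ls \<beta>] card by auto
  have "SSA d n (split_input n P (U \<union> W)) \<longleftrightarrow> k \<in> U" if "U \<subseteq> even_indices n \<inter> P" for U
  proof -
    \<comment> \<open>\<open>U\<close> lies inside \<open>P\<close> and \<open>?ls\<close> outside
      it, so \<open>U\<close> leaves the address unchanged.\<close>
    have "map (\<lambda>k. k \<in> U \<union> W) ?ls = \<beta>"
      unfolding W(2)[symmetric] using that by auto
    then have "SSA d n (split_input n P (U \<union> W)) = map (\<lambda>k. k \<in> U \<union> W) ?ks ! i"
      unfolding SSA_split_input[OF card] by (simp add: \<beta>(2))
    also have "\<dots> \<longleftrightarrow> k \<in> U"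
      using i k W(1) by auto
    finally show ?thesis .
  qed
  then have "SSA d n (split_input n P (S \<union> W)) \<noteq> SSA d n (split_input n P (T \<union> W))"
    using ST(1,2) k(2) by simp
  then show ?thesis using W(1) by auto
qed

lemma width_SSA_ge:
  assumes B: "is_obdd n B" "computes n B (SSA d n)" and n: "2 ^ d + d = n div 2"
  shows "2 ^ (2 ^ d) \<le> width B"
proof -
  let ?\<pi> = "var_order B" and ?E = "even_indices n"
  have perm: "?\<pi> permutes {1..n}" using B(1) by (simp add: is_obdd_def)
  then have "?E \<inter> ?\<pi> ` {1..n} = ?E"
    by (auto simp: permutes_image even_indices_def)
  \<comment> \<open>All \<open>2 ^ d + d\<close> even-indexed variables are read in the end, so the
    required cut exists.\<close>
  then have "2 ^ d \<le> card (?E \<inter> ?\<pi> ` {1..n})"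
    using n by (simp add: card_even_indices)
  then obtain j where j: "j \<le> n" "card (?E \<inter> ?\<pi> ` {1..j}) = 2 ^ d"
    using ex_card_Int_image_atMost_eq by blast
  \<comment> \<open>\<open>P\<close> may contain odd positions as well. The odd-indexed bits of
    \<open>split_input\<close> depend on \<open>P\<close> alone, so all inputs below agree on them,
    wherever they are read.\<close>
  define P where "P = ?\<pi> ` {1..j}"
  have card: "card (?E \<inter> P) = 2 ^ d" "card (?E - P) = d"
    using j(2) n card_Diff_subset_Int[of ?E P] by (auto simp: P_def card_even_indices)
  have in_P: "?\<pi> i \<in> P \<longleftrightarrow> i \<in> {1..j}" for i
    unfolding P_def by (rule inj_image_mem_iff[OF permutes_inj[OF perm]])
  let ?X = "split_input n P ` Pow (?E \<inter> P)"
  \<comment> \<open>The set \<open>S\<close> is recovered as the set of true even-indexed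
    variables.\<close>
  have "inj_on (split_input n P) (Pow (?E \<inter> P))"
  proof (rule inj_on_inverseI)
    fix S assume "S \<in> Pow (?E \<inter> P)"
    then show "{i \<in> ?E. split_input n P S i} = S"
      by (auto simp: split_input_def even_indices_def)
  qed
  then have "2 ^ (2 ^ d) = card ?X"
    using card by (simp add: card_image card_Pow del: Pow_Int_eq)
  also have "card ?X \<le> width B"
  proof (rule width_ge_card_fooling_set[OF B j(1)])
    fix x y assume "x \<in> ?X" "y \<in> ?X" "x \<noteq> y"
    then obtain S T where ST: "S \<subseteq> ?E \<inter> P" "T \<subseteq> ?E \<inter> P" "S \<noteq> T"
      and xy: "x = split_input n P S" "y = split_input n P T" by auto
    obtain W where W: "W \<subseteq> ?E - P"
      "SSA d n (split_input n P (S \<union> W)) \<noteq> SSA d n (split_input n P (T \<union> W))"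
      using SSA_split_input_distinguish[OF card ST] by blast
    show "\<exists>x'\<in>inputs n. \<exists>y'\<in>inputs n.
      (\<forall>i\<in>{1..j}. x' (?\<pi> i) = x (?\<pi> i) \<and> y' (?\<pi> i) = y (?\<pi> i)) \<and>
      (\<forall>i\<in>{j<..n}. x' (?\<pi> i) = y' (?\<pi> i)) \<and> SSA d n x' \<noteq> SSA d n y'"
    proof (intro bexI conjI ballI)
      fix i assume "i \<in> {1..j}"
      \<comment> \<open>Filling in the address bits \<open>W\<close> changes nothing that is read
        before the cut.\<close>
      then have "?\<pi> i \<notin> W" using W(1) in_P by blast
      then show "split_input n P (S \<union> W) (?\<pi> i) = x (?\<pi> i)"
        and "split_input n P (T \<union> W) (?\<pi> i) = y (?\<pi> i)"
        unfolding xy by (auto intro!: split_input_cong)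
    next
      fix i assume "i \<in> {j<..n}"
      \<comment> \<open>\<open>S\<close> and \<open>T\<close> lie inside \<open>P\<close>, so after
        the cut the even-indexed bits are those of \<open>W\<close> for both inputs.\<close>
      then have "?\<pi> i \<notin> P" by (simp add: in_P)
      then show "split_input n P (S \<union> W) (?\<pi> i) = split_input n P (T \<union> W) (?\<pi> i)"
        using ST by (intro split_input_cong) blast
    qed (use W(2) split_input_in_inputs in auto)
  qed
  finally show ?thesis .
qed

theorem theorem5:
  fixes d n :: nat
  assumes "d \<ge> 1" and "even n" and "2 ^ d + d = n div 2"
  shows "(\<forall>B :: 's obdd. is_obdd n B \<and> computes n B (SSA d n) \<longrightarrow> width B \<ge> 2 ^ (2 ^ d)) \<and>
         OBDD n (SSA d n) \<ge> 2 ^ (2 ^ d)"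
  \<comment> \<open>The bound on \<open>OBDD\<close> is the same width bound for states in
    \<open>nat\<close>.\<close>
  by (intro conjI allI impI le_OBDD) (simp_all add: width_SSA_ge[OF _ _ assms(3)])

end
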